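(* Let $\gamma>0$, $\varepsilon>0$, $\lambda\in\mathbb{R}^{n}_{\ge0}$ and $z\in\mathbb{R}^{n}$. The vector MLCP $f_{L,\gamma,\lambda}(z)=\sum_{i=1}^{n}f_{L,\gamma,\lambda_i}(z_i)$ is the optimal value of the following optimization problem: $$f_{L,\gamma,\lambda}(z)=\min_{\omega\in\mathbb{R}^{n}_{\ge0}}\left\{\|z\|_{L,\omega}+\frac{\gamma}{2}\|\omega-\lambda\|_{2}^{2}\right\},$$ where $\|z\|_{L,\omega}=\sum_{i=1}^{n}\omega_i\log\left(\frac{|z_i|}{\varepsilon}+1\right)$ and $\omega_i\ge0$, $i=1,\dots,n$, are the weights.
   Context: For scalars $\lambda\ge 0$, $\gamma>0$, $\varepsilon>0$, the (scalar) MLCP function is $$f_{L,\gamma,\lambda}(z)=\begin{cases}\lambda\log\left(\frac{|z|}{\varepsilon}+1\right)-\frac{1}{2\gamma}\log^{2}\left(\frac{|z|}{\varepsilon}+1\right), & |z|\le \varepsilon e^{\gamma\lambda}-\varepsilon,\\[2pt] \frac{\gamma\lambda^{2}}{2}, & |z|>\varepsilon e^{\gamma\lambda}-\varepsilon.\end{cases}$$ For a vector parameter $\lambda\in\mathbb{R}^n_{\ge0}$, the vector MLCP applies the scalar function with parameter $\lambda_i$ to the $i$-th entry and sums. *)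

theory Defs
  imports "HOL-Analysis.Analysis"
begin

definition mlcp :: "real \<Rightarrow> real \<Rightarrow> real \<Rightarrow> real \<Rightarrow> real" where
  "mlcp \<epsilon> \<gamma> l x =
    (if \<bar>x\<bar> \<le> \<epsilon> * exp (\<gamma> * l) - \<epsilon>
     then l * ln (\<bar>x\<bar> / \<epsilon> + 1) - 1 / (2 * \<gamma>) * (ln (\<bar>x\<bar> / \<epsilon> + 1))\<^sup>2
     else \<gamma> * l\<^sup>2 / 2)"

definition vec_mlcp :: "real \<Rightarrow> real \<Rightarrow> real ^ 'n \<Rightarrow> real ^ 'n \<Rightarrow> real" where
  "vec_mlcp \<epsilon> \<gamma> l z = (\<Sum>i\<in>UNIV. mlcp \<epsilon> \<gamma> (l $ i) (z $ i))"

definition weighted_log :: "real \<Rightarrow> real ^ 'n \<Rightarrow> real ^ 'n \<Rightarrow> real" where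
  "weighted_log \<epsilon> w z = (\<Sum>i\<in>UNIV. w $ i * ln (\<bar>z $ i\<bar> / \<epsilon> + 1))"

end

(* The objective is separable. With L = ln (|x|/\<epsilon> + 1), the scalar problem minimises the convex
   quadratic w L + \<gamma>/2 (w - l)^2 over w \<ge> 0; its minimiser is max 0 (l - L/\<gamma>), and the two
   branches of the MLCP function correspond to whether this constraint is inactive or active. *)
theory Submission
  imports Defs
begin

text \<open>Taking logarithms turns the threshold on \<open>\<bar>x\<bar>\<close> into
  \<open>L \<le> \<gamma> * l\<close>. For \<gamma> > 0 this says that the stationary point
  \<open>l - L / \<gamma>\<close> of the scalar objective is nonnegative.\<close>

lemma mlcp_eq_cases_ln:
  fixes \<gamma> \<epsilon> l x :: real
  assumes "\<epsilon> > 0"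
  defines "L \<equiv> ln (\<bar>x\<bar> / \<epsilon> + 1)"
  shows "mlcp \<epsilon> \<gamma> l x = (if L \<le> \<gamma> * l then l * L - L\<^sup>2 / (2 * \<gamma>) else \<gamma> * l\<^sup>2 / 2)"
proof -
  have pos: "\<bar>x\<bar> / \<epsilon> + 1 > 0"
    using assms(1) by (simp add: add_nonneg_pos)
  have "L \<le> \<gamma> * l \<longleftrightarrow> \<bar>x\<bar> / \<epsilon> + 1 \<le> exp (\<gamma> * l)"
    unfolding L_def by (metis exp_gt_zero ln_exp ln_le_cancel_iff pos)
  also have "\<dots> \<longleftrightarrow> \<bar>x\<bar> \<le> \<epsilon> * exp (\<gamma> * l) - \<epsilon>"
    using assms(1) by (simp add: field_simps)
  finally show ?thesis
    by (simp add: mlcp_def L_def)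
qed

text \<open>Lower-bound half of the scalar problem: in each branch the objective exceeds the MLCP
  value by manifestly nonnegative terms.\<close>

lemma mlcp_le:
  fixes \<gamma> \<epsilon> l x w :: real
  assumes "\<gamma> > 0" "\<epsilon> > 0" "w \<ge> 0"
  shows "mlcp \<epsilon> \<gamma> l x \<le> w * ln (\<bar>x\<bar> / \<epsilon> + 1) + \<gamma> / 2 * (w - l)\<^sup>2"
proof -
  define L where "L = ln (\<bar>x\<bar> / \<epsilon> + 1)"
  \<comment> \<open>Completing the square around the stationary point
    \<open>l - L / \<gamma>\<close>.\<close>
  have inactive: "w * L + \<gamma> / 2 * (w - l)\<^sup>2 = l * L - L\<^sup>2 / (2 * \<gamma>) + \<gamma> / 2 * (w - l + L / \<gamma>)\<^sup>2"
    using assms(1) by (simp add: field_simps power2_eq_square)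
  \<comment> \<open>Expansion around the boundary point \<open>w = 0\<close>: once
    \<open>L > \<gamma> * l\<close>, the linear term is nonnegative for
    \<open>w \<ge> 0\<close>.\<close>
  have active: "w * L + \<gamma> / 2 * (w - l)\<^sup>2 = \<gamma> * l\<^sup>2 / 2 + w * (L - \<gamma> * l) + \<gamma> / 2 * w\<^sup>2"
    by (simp add: field_simps power2_eq_square)
  show ?thesis
    unfolding mlcp_eq_cases_ln[OF assms(2)] L_def[symmetric]
  proof (cases "L \<le> \<gamma> * l")
    case True
    have "\<gamma> / 2 * (w - l + L / \<gamma>)\<^sup>2 \<ge> 0"
      using assms(1) by simp
    with inactive True show "(if L \<le> \<gamma> * l then l * L - L\<^sup>2 / (2 * \<gamma>) else \<gamma> * l\<^sup>2 / 2)
        \<le> w * L + \<gamma> / 2 * (w - l)\<^sup>2"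
      unfolding if_P[OF True] by linarith
  next
    case False
    have "w * (L - \<gamma> * l) \<ge> 0" "\<gamma> / 2 * w\<^sup>2 \<ge> 0"
      using assms False by simp_all
    with active False show "(if L \<le> \<gamma> * l then l * L - L\<^sup>2 / (2 * \<gamma>) else \<gamma> * l\<^sup>2 / 2)
        \<le> w * L + \<gamma> / 2 * (w - l)\<^sup>2"
      unfolding if_not_P[OF False] by linarith
  qed
qed

text \<open>Attainment half: \<open>w\<close> is the stationary point projected onto the half-line
  of nonnegative weights.\<close>

lemma mlcp_eq_at_minimizer:
  fixes \<gamma> \<epsilon> l x :: real
  assumes "\<gamma> > 0" "\<epsilon> > 0"
  defines "w \<equiv> max 0 (l - ln (\<bar>x\<bar> / \<epsilon> + 1) / \<gamma>)"
  shows "mlcp \<epsilon> \<gamma> l x = w * ln (\<bar>x\<bar> / \<epsilon> + 1) + \<gamma> / 2 * (w - l)\<^sup>2"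
proof -
  define L where "L = ln (\<bar>x\<bar> / \<epsilon> + 1)"
  \<comment> \<open>The maximum switches at the same threshold as the MLCP function, so the two case
    distinctions coincide.\<close>
  have w: "w = (if L \<le> \<gamma> * l then l - L / \<gamma> else 0)"
    unfolding w_def L_def[symmetric] using assms(1) by (auto simp: max_def field_simps)
  show ?thesis
    unfolding mlcp_eq_cases_ln[OF assms(2)] L_def[symmetric] w
    using assms(1) by (simp add: field_simps power2_eq_square)
qed

lemma objective_eq_sum:
  fixes l w z :: "real ^ 'n"
  shows "weighted_log \<epsilon> w z + \<gamma> / 2 * (norm (w - l))\<^sup>2
    = (\<Sum>i\<in>UNIV. w $ i * ln (\<bar>z $ i\<bar> / \<epsilon> + 1) + \<gamma> / 2 * (w $ i - l $ i)\<^sup>2)"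
proof -
  have "(norm (w - l))\<^sup>2 = (\<Sum>i\<in>UNIV. (w $ i - l $ i)\<^sup>2)"
    unfolding power2_norm_eq_inner inner_vec_def by (simp add: power2_eq_square)
  then show ?thesis
    by (simp only: weighted_log_def sum.distrib sum_distrib_left)
qed

theorem theorem3:
  fixes \<gamma> \<epsilon> :: real and l z :: "real ^ 'n"
  assumes "\<gamma> > 0" and "\<epsilon> > 0" and "\<forall>i. l $ i \<ge> 0"
  shows "\<exists>w. is_arg_min (\<lambda>w. weighted_log \<epsilon> w z + \<gamma> / 2 * (norm (w - l))\<^sup>2)
                 (\<lambda>w. \<forall>i. w $ i \<ge> 0) w
           \<and> vec_mlcp \<epsilon> \<gamma> l z = weighted_log \<epsilon> w z + \<gamma> / 2 * (norm (w - l))\<^sup>2"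
proof -
  \<comment> \<open>The constraint is coordinatewise too, so the scalar minimisers assemble into a
    feasible vector.\<close>
  define w :: "real ^ 'n" where "w = (\<chi> i. max 0 (l $ i - ln (\<bar>z $ i\<bar> / \<epsilon> + 1) / \<gamma>))"
  have eq: "vec_mlcp \<epsilon> \<gamma> l z = weighted_log \<epsilon> w z + \<gamma> / 2 * (norm (w - l))\<^sup>2"
    unfolding objective_eq_sum vec_mlcp_def w_def
    using mlcp_eq_at_minimizer[OF assms(1,2)] by simp
  have le: "vec_mlcp \<epsilon> \<gamma> l z \<le> weighted_log \<epsilon> v z + \<gamma> / 2 * (norm (v - l))\<^sup>2"
    if "\<forall>i. v $ i \<ge> 0" for v
    unfolding objective_eq_sum vec_mlcp_def
    using that by (intro sum_mono mlcp_le assms(1,2)) simp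
  have "\<forall>i. w $ i \<ge> 0"
    by (simp add: w_def)
  with eq le show ?thesis
    unfolding is_arg_min_linorder by metis
qed

end
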